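(* Let $X,Y$ be Polish spaces and let $\mu\in\mathcal P(X)$, $\nu\in\mathcal P(Y)$ be continuous (i.e. non-atomic). Then $\mathrm{Cpl}_{biM}(\mu,\nu)$ is weakly dense in $\mathrm{Cpl}(\mu,\nu)$. Moreover, if $p\in[1,\infty)$ and $\mu,\nu$ have finite $p$-th moments with respect to compatible metrics $d_X,d_Y$, then $\mathrm{Cpl}_{biM}(\mu,\nu)$ is dense in $\mathrm{Cpl}(\mu,\nu)$ with respect to $\mathcal W_p$ for the product metric $d^p=d_X^p+d_Y^p$ on $X\times Y$.
   Context: $\mathrm{Cpl}(\mu,\nu)$ is the set of couplings of $\mu,\nu$; $\mathrm{Cpl}_{biM}(\mu,\nu)=\{(\mathrm{id},T)_\ast\mu: T:X\to Y \text{ Borel bijection}, T_\ast\mu=\nu\}$. $\mathcal W_p^p(\alpha,\beta)=\inf_{\gamma\in\mathrm{Cpl}(\alpha,\beta)}\int d^p\,d\gamma$. Standing assumption: Polish spaces are uncountable. *)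

theory Defs
  imports "HOL-Probability.Probability"
begin

definition Prob :: "'a::topological_space measure set" where
  "Prob = {M. prob_space M \<and> sets M = sets borel}"

definition continuous_measure :: "'a::topological_space measure \<Rightarrow> bool" where
  "continuous_measure M \<longleftrightarrow> (\<forall>x. emeasure M {x} = 0)"

definition Cpl :: "'a::topological_space measure \<Rightarrow> 'b::topological_space measure
    \<Rightarrow> ('a \<times> 'b) measure set" where
  "Cpl \<mu> \<nu> = {\<gamma> \<in> Prob. distr \<gamma> borel fst = \<mu> \<and> distr \<gamma> borel snd = \<nu>}"

definition Cpl_biM :: "'a::topological_space measure \<Rightarrow> 'b::topological_space measure
    \<Rightarrow> ('a \<times> 'b) measure set" where
  "Cpl_biM \<mu> \<nu> = {distr \<mu> borel (\<lambda>x. (x, T x)) | T.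
      bij T \<and> T \<in> borel_measurable borel \<and> distr \<mu> borel T = \<nu>}"

definition weak_topology :: "'a::topological_space measure topology" where
  "weak_topology = topology_generated_by
     {{\<gamma> \<in> Prob. integral\<^sup>L \<gamma> f \<in> U} | f U.
        continuous_on UNIV f \<and> bounded (range f) \<and> open (U :: real set)}"

definition compatible_metric :: "('a::topological_space \<Rightarrow> 'a \<Rightarrow> real) \<Rightarrow> bool" where
  "compatible_metric d \<longleftrightarrow> Metric_space UNIV d \<and> Metric_space.mtopology UNIV d = euclidean"

definition finite_moment :: "('a \<Rightarrow> 'a \<Rightarrow> real) \<Rightarrow> real \<Rightarrow> 'a measure \<Rightarrow> bool" where
  "finite_moment d p M \<longleftrightarrow> (\<exists>x0. (\<integral>\<^sup>+ x. ennreal (d x0 x powr p) \<partial>M) < \<infinity>)"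

definition prod_dist_p :: "('a \<Rightarrow> 'a \<Rightarrow> real) \<Rightarrow> ('b \<Rightarrow> 'b \<Rightarrow> real) \<Rightarrow> real
    \<Rightarrow> ('a \<times> 'b) \<Rightarrow> ('a \<times> 'b) \<Rightarrow> real" where
  "prod_dist_p dX dY p z w = dX (fst z) (fst w) powr p + dY (snd z) (snd w) powr p"

text \<open>W_p^p(alpha,beta) = inf over couplings of the integral of d^p, for the cost c = d^p.\<close>
definition Wpp :: "('c::topological_space \<Rightarrow> 'c \<Rightarrow> real) \<Rightarrow> 'c measure \<Rightarrow> 'c measure \<Rightarrow> ennreal" where
  "Wpp c \<alpha> \<beta> = (INF \<pi>\<in>Cpl \<alpha> \<beta>. \<integral>\<^sup>+ zw. ennreal (c (fst zw) (snd zw)) \<partial>\<pi>)"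

end

theory Submission
  imports Defs
begin

text \<open>
  Let \<open>\<gamma>\<close> be a coupling of \<open>\<mu>\<close> and \<open>\<nu>\<close>, and partition \<open>X\<close> and \<open>Y\<close> into countably many Borel cells of
  diameter less than \<open>\<delta>\<close>. All three measures are atomless, and two atomless Borel probabilities on
  Polish spaces are isomorphic modulo null sets; the isomorphism can be chosen to respect countable
  partitions whose cells have matching masses, because the quantile transform is monotone. So there
  are isomorphisms \<open>\<Phi> : (X, \<mu>) \<rightarrow> (X \<times> Y, \<gamma>)\<close> preserving the \<open>X\<close>-cell and
  \<open>\<Psi> : (X \<times> Y, \<gamma>) \<rightarrow> (Y, \<nu>)\<close> preserving the \<open>Y\<close>-cell. With \<open>T = \<Psi> \<circ> \<Phi>\<close>, the law of
  \<open>(\<Phi> x, (x, T x))\<close> under \<open>\<mu>\<close> couples \<open>\<gamma>\<close> with \<open>(id, T)\<^sub>*\<mu>\<close> and moves each coordinate by less than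
  \<open>\<delta>\<close>. Finally \<open>T\<close> is changed on a null set into a Borel bijection by a Schroeder-Bernstein argument,
  since every atomless probability has a null set containing a Borel copy of the real line.
\<close>

subsection \<open>Borel codes of Polish spaces by reals\<close>

text \<open>Powers of 1/3 instead of 1/2 make the expansion unique: the digits after the first
  contribute at most 1/6, less than the first weight 1/3.\<close>

definition real_of_bits :: "(nat \<Rightarrow> bool) \<Rightarrow> real" where
  "real_of_bits b = (\<Sum>i. of_bool (b i) * (1/3) ^ Suc i)"

lemma
  shows real_of_bits_nonneg: "0 \<le> real_of_bits b"
    and real_of_bits_le: "real_of_bits b \<le> 1/2"
    and real_of_bits_rec: "real_of_bits b = of_bool (b 0) / 3 + real_of_bits (\<lambda>i. b (Suc i)) / 3"
proof -
  have geo: "summable (\<lambda>i. (1/3::real) ^ Suc i)" "(\<Sum>i. (1/3::real) ^ Suc i) = 1/2"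
    using sums_mult[OF geometric_sums[of "1/3::real"], of "1/3"] by (auto simp: sums_iff)
  have sm: "summable (\<lambda>i. of_bool (b i) * (1/3::real) ^ Suc i)" for b :: "nat \<Rightarrow> bool"
    by (rule summable_comparison_test'[OF geo(1), of 0]) auto
  show "0 \<le> real_of_bits b" unfolding real_of_bits_def by (intro suminf_nonneg sm) auto
  show "real_of_bits b \<le> 1/2"
    unfolding real_of_bits_def geo(2)[symmetric] by (intro suminf_le sm geo(1)) auto
  have "real_of_bits (\<lambda>i. b (Suc i)) / 3 = (\<Sum>i. of_bool (b (Suc i)) * (1/3) ^ Suc (Suc i))"
    unfolding real_of_bits_def by (subst suminf_divide[OF sm, symmetric]) simp
  also have "\<dots> = real_of_bits b - of_bool (b 0) / 3"
    using suminf_split_head[OF sm[of b]] by (simp add: real_of_bits_def)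
  finally show "real_of_bits b = of_bool (b 0) / 3 + real_of_bits (\<lambda>i. b (Suc i)) / 3" by linarith
qed

lemma borel_measurable_real_of_bits:
  assumes [measurable]: "\<And>i. Measurable.pred M (b i)"
  shows "(\<lambda>x. real_of_bits (\<lambda>i. b i x)) \<in> borel_measurable M"
  unfolding real_of_bits_def by measurable

text \<open>Deleting the leading digit is a Borel map of the line, so its iterates bring each digit
  to the front, where a threshold reads it.\<close>

lemma real_of_bits_digits:
  obtains D :: "nat \<Rightarrow> real \<Rightarrow> bool"
  where "\<And>i. Measurable.pred borel (D i)" and "\<And>b i. D i (real_of_bits b) = b i"
proof -
  \<comment> \<open>The threshold 1/4 separates the values with leading digit 0, in [0, 1/6], from
    those with leading digit 1, in [1/3, 1/2].\<close>
  define sh where "sh = (\<lambda>r::real. 3 * r - of_bool (r > 1/4))"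
  have head: "real_of_bits b > 1/4 \<longleftrightarrow> b 0" for b
    using real_of_bits_rec[of b] real_of_bits_nonneg[of "\<lambda>i. b (Suc i)"]
      real_of_bits_le[of "\<lambda>i. b (Suc i)"] by (cases "b 0") auto
  have "sh (real_of_bits b) = real_of_bits (\<lambda>i. b (Suc i))" for b
    unfolding sh_def head using real_of_bits_rec[of b] by auto
  then have shift: "(sh ^^ i) (real_of_bits b) = real_of_bits (\<lambda>j. b (i + j))" for i b
    by (induction i arbitrary: b) (auto simp: funpow_swap1)
  have "sh \<in> borel_measurable borel" unfolding sh_def by measurable
  then have [measurable]: "(sh ^^ i) \<in> borel_measurable borel" for i
    by (induction i) (auto simp: comp_def intro: measurable_compose)
  show ?thesis
  proof (rule that[of "\<lambda>i r. (sh ^^ i) r > 1/4"])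
    show "Measurable.pred borel (\<lambda>r. (sh ^^ i) r > 1/4)" for i by measurable
    show "((sh ^^ i) (real_of_bits b) > 1/4) = b i" for b i
      using head[of "\<lambda>j. b (i + j)"] by (simp add: shift)
  qed
qed

text \<open>
  The code of \<open>x\<close> stores, for each \<open>k\<close>, the index of the first point of a dense sequence at distance
  less than \<open>1 / (k + 1)\<close> from \<open>x\<close>; completeness makes the limit of these points a Borel left inverse
  defined on all reals, which is why images of Borel sets under the code are Borel.
\<close>

lemma borel_code:
  obtains a :: "'a::{complete_space,second_countable_topology} \<Rightarrow> real" and d :: "real \<Rightarrow> 'a"
  where "a \<in> borel_measurable borel" and "d \<in> borel_measurable borel"
    and "\<And>x. d (a x) = x" and "\<And>x. 0 < a x" and "\<And>x. a x < 1"
proof -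
  obtain D where D[measurable]: "\<And>i. Measurable.pred borel (D i)"
    and D_bits: "\<And>b i. D i (real_of_bits b) = b i"
    using real_of_bits_digits by blast
  obtain Q :: "'a set" where Q: "countable Q" "\<And>U. open U \<Longrightarrow> U \<noteq> {} \<Longrightarrow> \<exists>q\<in>Q. q \<in> U"
    using countable_dense_exists by blast
  have "Q \<noteq> {}" using Q(2)[of UNIV] by auto
  define q where "q = from_nat_into Q"
  define n where "n = (\<lambda>k x. LEAST n. dist (q n) x < 1 / real (Suc k))"
  have n: "dist (q (n k x)) x < 1 / real (Suc k)" for k x
  proof -
    have "\<exists>y\<in>Q. y \<in> ball x (1 / real (Suc k))" by (rule Q(2)) auto
    then obtain m where "dist (q m) x < 1 / real (Suc k)"
      by (metis Q(1) \<open>Q \<noteq> {}\<close> dist_commute from_nat_into_surj mem_ball q_def)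
    then show ?thesis unfolding n_def by (rule LeastI)
  qed
  have nm[measurable]: "n k \<in> measurable borel (count_space UNIV)" for k
    unfolding n_def by measurable
  \<comment> \<open>The bits list the graph of \<open>\<lambda>k. n k x\<close>. The offset 1/4
    moves the code from [0, 1/2] into [1/4, 3/4], strictly inside the unit interval.\<close>
  define a where "a = (\<lambda>x. 1/4 + real_of_bits (\<lambda>i. n (fst (prod_decode i)) x = snd (prod_decode i)))"
  define m where "m = (\<lambda>k r. LEAST j. D (prod_encode (k, j)) (r - 1/4))"
  have ma: "m k (a x) = n k x" for k x
    by (auto simp: m_def a_def D_bits intro: Least_equality)
  have mm[measurable]: "m k \<in> measurable borel (count_space UNIV)" for k
    unfolding m_def by measurable
  have qm[measurable]: "(\<lambda>r. q (m k r)) \<in> borel_measurable borel" for k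
    by (rule measurable_compose[OF mm]) auto
  \<comment> \<open>Off the Cauchy set \<open>q 0\<close> is an arbitrary default. It also replaces
    the approximants there, so that they converge at every real and the limit is Borel.\<close>
  define d where "d = (\<lambda>r. if Cauchy (\<lambda>k. q (m k r)) then lim (\<lambda>k. q (m k r)) else q 0)"
  have "d \<in> borel_measurable borel"
  proof (rule borel_measurable_LIMSEQ_metric)
    show "(\<lambda>r. if Cauchy (\<lambda>k. q (m k r)) then q (m k r) else q 0) \<in> borel_measurable borel" for k
      by measurable
    show "(\<lambda>k. if Cauchy (\<lambda>k. q (m k r)) then q (m k r) else q 0) \<longlonglongrightarrow> d r" for r
      by (auto simp: d_def Cauchy_convergent_iff convergent_LIMSEQ_iff)
  qed
  moreover have "d (a x) = x" for x
  proof -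
    have "(\<lambda>k. dist (q (n k x)) x) \<longlonglongrightarrow> 0"
      using n by (intro tendsto_sandwich[OF _ _ tendsto_const lim_1_over_n[THEN LIMSEQ_Suc]])
        (auto intro!: always_eventually less_imp_le)
    then have "(\<lambda>k. q (n k x)) \<longlonglongrightarrow> x" by (simp add: tendsto_dist_iff[of _ x])
    then show ?thesis
      by (auto simp: d_def ma limI LIMSEQ_imp_Cauchy)
  qed
  moreover have "a \<in> borel_measurable borel"
    unfolding a_def by (intro borel_measurable_add borel_measurable_real_of_bits) measurable
  moreover have "0 < a x" "a x < 1" for x
    unfolding a_def by (simp_all add: add_pos_nonneg real_of_bits_nonneg le_less_trans[OF add_left_mono[OF real_of_bits_le]])
  ultimately show ?thesis using that by blast
qed

subsection \<open>Isomorphisms modulo null sets\<close>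

text \<open>Both maps are total Borel functions and only one inverse relation is recorded;
  \<open>ae_iso_sym\<close> recovers the other one and the reverse push-forward.\<close>

definition ae_iso :: "'a::topological_space measure \<Rightarrow> 'b::topological_space measure
    \<Rightarrow> ('a \<Rightarrow> 'b) \<Rightarrow> ('b \<Rightarrow> 'a) \<Rightarrow> bool" where
  "ae_iso M N f g \<longleftrightarrow> sets M = sets borel \<and> f \<in> borel_measurable borel \<and>
     g \<in> borel_measurable borel \<and> distr M borel f = N \<and> (AE x in M. g (f x) = x)"

lemma ae_iso_AE:
  assumes "ae_iso M N f g" and "AE y in N. P y"
  shows "AE x in M. P (f x)"
proof -
  have "f \<in> measurable M borel" "N = distr M borel f"
    using assms(1) by (auto simp: ae_iso_def cong: measurable_cong_sets)
  then show ?thesis using assms(2) AE_distrD by blast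
qed

text \<open>Wherever \<open>g (f x) = x\<close>, the point \<open>y = f x\<close> satisfies
  \<open>f (g y) = y\<close>. This equality set is Borel, so the property passes to the
  push-forward.\<close>

lemma ae_iso_sym:
  fixes f :: "'a::{second_countable_topology,t2_space} \<Rightarrow> 'b::{second_countable_topology,t2_space}"
  assumes "ae_iso M N f g"
  shows "ae_iso N M g f"
proof -
  have sM: "sets M = sets borel" and [measurable]: "f \<in> borel_measurable borel" "g \<in> borel_measurable borel"
    and N: "N = distr M borel f" and ae: "AE x in M. g (f x) = x"
    using assms by (auto simp: ae_iso_def)
  have [measurable_cong]: "sets M = sets borel" by fact
  have "distr N borel g = distr M borel (\<lambda>x. g (f x))"
    unfolding N by (subst distr_distr) (auto simp: comp_def)
  also have "\<dots> = distr M M (\<lambda>x. x)"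
    by (rule distr_cong_AE) (use ae sM in auto)
  finally have "distr N borel g = M" by (simp add: distr_id)
  moreover have "AE y in N. f (g y) = y"
    unfolding N by (subst AE_distr_iff) (use ae in auto)
  ultimately show ?thesis unfolding ae_iso_def by (simp add: N)
qed

lemma ae_iso_trans:
  assumes 1: "ae_iso M N f g" and 2: "ae_iso N L h k"
  shows "ae_iso M L (\<lambda>x. h (f x)) (\<lambda>z. g (k z))"
proof -
  have [measurable_cong]: "sets M = sets borel"
    and [measurable]: "f \<in> borel_measurable borel" "g \<in> borel_measurable borel"
      "h \<in> borel_measurable borel" "k \<in> borel_measurable borel"
    and N: "N = distr M borel f" "L = distr N borel h" and ae: "AE x in M. g (f x) = x"
    using 1 2 by (auto simp: ae_iso_def)
  have "AE x in M. k (h (f x)) = f x"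
    using ae_iso_AE[OF 1] 2 by (auto simp: ae_iso_def)
  with ae have "AE x in M. g (k (h (f x))) = x" by eventually_elim simp
  moreover have "distr M borel (\<lambda>x. h (f x)) = L"
    unfolding N by (subst distr_distr) (auto simp: comp_def)
  ultimately show ?thesis using \<open>sets M = sets borel\<close> by (auto simp: ae_iso_def)
qed

lemma ae_iso_embedding:
  assumes "sets M = sets borel" "f \<in> borel_measurable borel" "g \<in> borel_measurable borel"
    and "\<And>x. g (f x) = x"
  shows "ae_iso M (distr M borel f) f g"
  using assms by (simp add: ae_iso_def)

section \<open>The quantile transform on the real line\<close>

definition quantile :: "real measure \<Rightarrow> real \<Rightarrow> real" where
  "quantile M u = (if 0 < u \<and> u < 1 then Inf {x. u \<le> cdf M x} else 0)"

abbreviation unif01 :: "real measure" where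
  "unif01 \<equiv> uniform_measure lborel {0<..<1}"

lemma AE_unif01: "AE u in unif01. 0 < u \<and> u < 1"
  using AE_uniform_measureI[of "{0<..<1}" lborel "\<lambda>u::real. 0 < u \<and> u < 1"] by auto

lemma prob_space_unif01: "prob_space unif01"
  by (rule prob_space_uniform_measure) auto

context
  fixes M :: "real measure"
  assumes M: "real_distribution M"
begin

interpretation cdf_distribution M by (simp add: cdf_distribution_def M)

lemma quantile_le_iff: "0 < u \<Longrightarrow> u < 1 \<Longrightarrow> quantile M u \<le> x \<longleftrightarrow> u \<le> cdf M x"
  unfolding quantile_def using pseudoinverse[of u x] by simp

lemma borel_measurable_quantile: "quantile M \<in> borel_measurable borel"
proof -
  have "(\<lambda>u. if u \<in> {0<..<1} then Inf {x. u \<le> cdf M x} else 0) \<in> borel_measurable borel"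
    by (subst measurable_If_restrict_space_iff) (auto simp del: greaterThanLessThan_iff)
  then show ?thesis by (simp add: quantile_def[abs_def])
qed

lemma distr_quantile: "distr unif01 borel (quantile M) = M"
proof (rule measure_eqI)
  note [measurable] = borel_measurable_quantile
  fix A assume "A \<in> sets (distr unif01 borel (quantile M))"
  then have [measurable]: "A \<in> sets borel" by simp
  let ?R = "restrict_space lborel {0<..<1::real}"
  \<comment> \<open>\<open>I\<close> is the generalized inverse of the distribution function
    supplied by the locale \<open>cdf_distribution\<close>; on (0, 1) it agrees with
    \<open>quantile M\<close>.\<close>
  have "emeasure M A = emeasure (distr ?R borel I) A" by (simp add: distr_I_eq_M)
  also have "\<dots> = emeasure ?R (I -` A \<inter> space ?R)" by (rule emeasure_distr) auto
  also have "I -` A \<inter> space ?R = {0<..<1} \<inter> quantile M -` A"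
    by (auto simp: space_restrict_space quantile_def)
  also have "emeasure ?R \<dots> = emeasure lborel ({0<..<1} \<inter> quantile M -` A)"
    by (rule emeasure_restrict_space) auto
  also have "\<dots> = emeasure unif01 (quantile M -` A)"
    by (subst emeasure_uniform_measure)
       (auto simp: divide_ennreal_def measurable_sets_borel[OF borel_measurable_quantile])
  also have "\<dots> = emeasure (distr unif01 borel (quantile M)) A"
    by (subst emeasure_distr) auto
  finally show "emeasure (distr unif01 borel (quantile M)) A = emeasure M A" ..
qed simp

text \<open>Without atoms the distribution function is left-continuous. If it exceeded
  \<open>u\<close> at the quantile, it would already do so slightly to the left, against
  minimality.\<close>

lemma cdf_quantile:
  assumes "\<And>x. measure M {x} = 0" and u: "0 < u" "u < 1"
  shows "cdf M (quantile M u) = u"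
proof (rule antisym)
  show "u \<le> cdf M (quantile M u)" using quantile_le_iff[OF u] by blast
  show "cdf M (quantile M u) \<le> u"
  proof (rule ccontr)
    assume "\<not> ?thesis"
    moreover have "(cdf M \<longlongrightarrow> cdf M (quantile M u)) (at_left (quantile M u))"
      using assms(1) isCont_cdf by (metis isCont_def filterlim_at_split)
    ultimately have "eventually (\<lambda>x. u < cdf M x) (at_left (quantile M u))"
      by (intro order_tendstoD) auto
    moreover have "eventually (\<lambda>x. x < quantile M u) (at_left (quantile M u))"
      by (simp add: eventually_at_filter)
    ultimately have "eventually (\<lambda>x. False) (at_left (quantile M u))"
      by eventually_elim (use quantile_le_iff[OF u] in \<open>meson less_imp_le not_le\<close>)
    then show False by simp
  qed
qed

lemma ae_iso_quantile:
  assumes "\<And>x. measure M {x} = 0"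
  shows "ae_iso unif01 M (quantile M) (cdf M)"
proof -
  have "AE u in unif01. cdf M (quantile M u) = u"
    using AE_unif01 by eventually_elim (rule cdf_quantile[OF assms], auto)
  then show ?thesis
    by (simp add: ae_iso_def borel_measurable_quantile distr_quantile)
qed

text \<open>A quantile outside \<open>K\<close> would have a massless interval to its left, so the
  same level would be reached earlier. The conclusion holds for every level in (0, 1), not just
  almost every one.\<close>

lemma quantile_in_closed:
  assumes K: "closed K" "measure M K = 1" and u: "0 < u" "u < 1"
  shows "quantile M u \<in> K"
proof (rule ccontr)
  assume "quantile M u \<notin> K"
  then obtain e where e: "e > 0" "ball (quantile M u) e \<subseteq> - K"
    using K(1) by (meson ComplI open_Compl open_contains_ball)
  define y where "y = quantile M u - e / 2"
  have "{y<..quantile M u} \<inter> K = {}"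
    using e unfolding y_def by (auto simp: subset_iff dist_real_def)
  moreover have "K \<in> sets M" using K by auto
  moreover have "AE x in M. x \<in> K" using K(2) calculation(2) by (simp add: prob_eq_1)
  ultimately have "prob {y<..quantile M u} = 0"
    by (subst prob_eq_0) (auto elim!: eventually_mono)
  then have "cdf M (quantile M u) = cdf M y"
    using cdf_diff_eq[of y "quantile M u"] e by (simp add: y_def)
  then have "quantile M u \<le> y"
    using quantile_le_iff[OF u, of y] quantile_le_iff[OF u, of "quantile M u"] by simp
  then show False using e by (simp add: y_def)
qed

end

section \<open>Isomorphisms that respect countable labels\<close>

lemma borel_measurable_fst [measurable]: "fst \<in> borel_measurable borel"
  by (intro borel_measurable_continuous_onI continuous_intros)

lemma borel_measurable_snd [measurable]: "snd \<in> borel_measurable borel"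
  by (intro borel_measurable_continuous_onI continuous_intros)

lemma space_Prob: "\<mu> \<in> Prob \<Longrightarrow> space \<mu> = UNIV"
  by (auto simp: Prob_def dest: sets_eq_imp_space_eq)

text \<open>The increasing rearrangement of \<open>M\<close> to \<open>N\<close> cannot cross an
  integer, since both measures have the same mass below each of them.\<close>

lemma AE_quantile_cdf_ceiling:
  assumes M: "real_distribution M" "\<And>x. measure M {x} = 0"
    and N: "real_distribution N" "\<And>x. measure N {x} = 0"
    and eq: "\<And>n::int. cdf M (of_int n) = cdf N (of_int n)"
  shows "AE r in M. \<lceil>quantile N (cdf M r)\<rceil> = \<lceil>r\<rceil>"
proof -
  interpret M: real_distribution M by fact
  \<comment> \<open>At a level \<open>u = cdf N (n - 1)\<close> the quantile falls back to at most
    \<open>n - 1\<close>. These levels are countably many and can be discarded.\<close>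
  let ?C = "range (\<lambda>n::int. cdf N (of_int n))"
  have "?C \<in> null_sets lborel"
    by (intro countable_imp_null_set_lborel) auto
  then have "AE u in lborel. u \<notin> ?C" by (rule AE_not_in)
  then have "AE u in unif01. u \<notin> ?C"
    by (intro AE_uniform_measureI) (auto elim!: eventually_mono)
  with AE_unif01 have "AE u in unif01. 0 < u \<and> u < 1 \<and> u \<notin> ?C" by eventually_elim auto
  from ae_iso_AE[OF ae_iso_sym[OF ae_iso_quantile[OF M]] this]
  show ?thesis
  proof eventually_elim
    case (elim r)
    let ?n = "\<lceil>r\<rceil>"
    have "cdf M r \<le> cdf N (of_int ?n)" unfolding eq[symmetric] by (rule M.cdf_nondecreasing) simp
    then have "quantile N (cdf M r) \<le> of_int ?n" using quantile_le_iff[OF N(1)] elim by simp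
    moreover have "cdf N (of_int (?n - 1)) \<le> cdf M r"
      unfolding eq[symmetric] by (rule M.cdf_nondecreasing) linarith
    then have "cdf N (of_int (?n - 1)) < cdf M r" using elim by (metis order_le_less rangeI)
    then have "of_int (?n - 1) < quantile N (cdf M r)"
      using quantile_le_iff[OF N(1), of "cdf M r" "of_int (?n - 1)"] elim by linarith
    ultimately show ?case by (simp add: ceiling_eq_iff)
  qed
qed

text \<open>
  Labels become integer parts of the codes, so that equality of the label laws is equality of the
  distribution functions at all integers.
\<close>

lemma borel_code_labelled:
  fixes c :: "'a::{complete_space,second_countable_topology} \<Rightarrow> nat"
  assumes [measurable]: "c \<in> measurable borel (count_space UNIV)"
  obtains a :: "'a \<Rightarrow> real" and d :: "real \<Rightarrow> 'a"
  where "a \<in> borel_measurable borel" and "d \<in> borel_measurable borel"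
    and "\<And>x. d (a x) = x" and "\<And>x. \<lceil>a x\<rceil> = int (c x) + 1"
proof -
  obtain a :: "'a \<Rightarrow> real" and d where ad[measurable]: "a \<in> borel_measurable borel" "d \<in> borel_measurable borel"
    and da: "\<And>x. d (a x) = x" and a01: "\<And>x. 0 < a x" "\<And>x. a x < 1"
    using borel_code[where 'a = 'a] by blast
  show ?thesis
  \<comment> \<open>The code lies strictly between 0 and 1, so the ceiling of the sum is the label
    plus one and its fractional part is the code.\<close>
  proof (rule that[of "\<lambda>x. real (c x) + a x" "\<lambda>r. d (frac r)"])
    show "(\<lambda>x. real (c x) + a x) \<in> borel_measurable borel" by measurable
    show "(\<lambda>r. d (frac r)) \<in> borel_measurable borel" unfolding frac_def by measurable
    fix x
    have "frac (real (c x) + a x) = a x"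
      using a01[of x] by (simp add: frac_unique_iff)
    then show "d (frac (real (c x) + a x)) = x" using da by simp
    show "\<lceil>real (c x) + a x\<rceil> = int (c x) + 1" using a01[of x] by (simp add: ceiling_eq_iff)
  qed
qed

lemma real_distribution_distr_Prob:
  assumes "\<mu> \<in> Prob" "a \<in> borel_measurable borel"
  shows "real_distribution (distr \<mu> borel a)"
proof -
  have "prob_space \<mu>" "sets \<mu> = sets borel" using assms by (auto simp: Prob_def)
  then show ?thesis using assms(2)
    by (intro prob_space.real_distribution_distr) (auto cong: measurable_cong_sets)
qed

lemma continuous_measure_distr:
  fixes a :: "'a::t2_space \<Rightarrow> 'b::t2_space"
  assumes "sets \<mu> = sets borel" "a \<in> borel_measurable borel" "\<And>x. d (a x) = x" "continuous_measure \<mu>"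
  shows "continuous_measure (distr \<mu> borel a)"
  unfolding continuous_measure_def
proof
  fix y
  have [measurable]: "a \<in> measurable \<mu> borel" using assms by (auto cong: measurable_cong_sets)
  have "emeasure (distr \<mu> borel a) {y} = emeasure \<mu> (a -` {y} \<inter> space \<mu>)"
    by (rule emeasure_distr) auto
  also have "\<dots> \<le> emeasure \<mu> {d y}"
    using assms(1,3) by (intro emeasure_mono) auto
  also have "\<dots> = 0" using assms(4) by (simp add: continuous_measure_def)
  finally show "emeasure (distr \<mu> borel a) {y} = 0" by simp
qed

text \<open>The isomorphism runs through the codes: encode, rearrange monotonically through the
  uniform law, decode. Labels survive because they are the ceilings of the codes.\<close>

lemma ae_iso_labelled:
  fixes \<mu> :: "'a::{complete_space,second_countable_topology} measure"
    and \<nu> :: "'b::{complete_space,second_countable_topology} measure"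
    and c :: "'a \<Rightarrow> nat" and e :: "'b \<Rightarrow> nat"
  assumes \<mu>: "\<mu> \<in> Prob" "continuous_measure \<mu>" and \<nu>: "\<nu> \<in> Prob" "continuous_measure \<nu>"
    and c: "c \<in> measurable borel (count_space UNIV)" and e: "e \<in> measurable borel (count_space UNIV)"
    and eq: "distr \<mu> (count_space UNIV) c = distr \<nu> (count_space UNIV) e"
  obtains f g where "ae_iso \<mu> \<nu> f g" and "AE x in \<mu>. e (f x) = c x"
proof -
  have s[measurable_cong]: "sets \<mu> = sets borel" "sets \<nu> = sets borel"
    using \<mu> \<nu> by (auto simp: Prob_def)
  have sp[simp]: "space \<mu> = UNIV" "space \<nu> = UNIV" using s[THEN sets_eq_imp_space_eq] by auto
  note [measurable] = c e
  obtain a :: "'a \<Rightarrow> real" and d where ad[measurable]: "a \<in> borel_measurable borel" "d \<in> borel_measurable borel"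
    and da: "\<And>x. d (a x) = x" and ac: "\<And>x. \<lceil>a x\<rceil> = int (c x) + 1"
    using borel_code_labelled[OF c] by blast
  obtain a' :: "'b \<Rightarrow> real" and d' where ad'[measurable]: "a' \<in> borel_measurable borel" "d' \<in> borel_measurable borel"
    and da': "\<And>x. d' (a' x) = x" and ae: "\<And>x. \<lceil>a' x\<rceil> = int (e x) + 1"
    using borel_code_labelled[OF e] by blast
  define M where "M = distr \<mu> borel a"
  define N where "N = distr \<nu> borel a'"
  have M: "real_distribution M" and N: "real_distribution N"
    unfolding M_def N_def using \<mu> \<nu> by (auto intro: real_distribution_distr_Prob)
  have "continuous_measure M" "continuous_measure N"
    unfolding M_def N_def
    using continuous_measure_distr[OF s(1) ad(1) da \<mu>(2)] continuous_measure_distr[OF s(2) ad'(1) da' \<nu>(2)]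
    by auto
  then have M0: "measure M {x} = 0" and N0: "measure N {x} = 0" for x
    by (auto simp: continuous_measure_def measure_def)
  have "cdf M (of_int n) = measure (distr \<mu> (count_space UNIV) c) {k. int k + 1 \<le> n}" for n :: int
    unfolding cdf_def M_def
    by (subst (1 2) measure_distr) (auto intro!: arg_cong[of _ _ "measure \<mu>"] simp: ac[symmetric] ceiling_le_iff)
  moreover have "cdf N (of_int n) = measure (distr \<nu> (count_space UNIV) e) {k. int k + 1 \<le> n}" for n :: int
    unfolding cdf_def N_def
    by (subst (1 2) measure_distr) (auto intro!: arg_cong[of _ _ "measure \<nu>"] simp: ae[symmetric] ceiling_le_iff)
  ultimately have cdf_eq: "cdf M (of_int n) = cdf N (of_int n)" for n :: int
    by (simp add: eq)
  have iM: "ae_iso \<mu> M a d" and iN: "ae_iso N \<nu> d' a'"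
    unfolding M_def N_def
    using ae_iso_embedding[OF s(1) ad da] ae_iso_sym[OF ae_iso_embedding[OF s(2) ad' da']] by auto
  have iMN: "ae_iso M N (\<lambda>r. quantile N (cdf M r)) (\<lambda>r. quantile M (cdf N r))"
    using ae_iso_trans[OF ae_iso_sym[OF ae_iso_quantile[OF M M0]] ae_iso_quantile[OF N N0]] .
  \<comment> \<open>The decoder \<open>d'\<close> inverts \<open>a'\<close> only on the range of
    \<open>a'\<close>, so re-encoding returns the given real only almost everywhere.\<close>
  have "AE r in M. a' (d' (quantile N (cdf M r))) = quantile N (cdf M r)"
    using ae_iso_AE[OF iMN] iN by (auto simp: ae_iso_def)
  with AE_quantile_cdf_ceiling[OF M M0 N N0 cdf_eq]
  have "AE r in M. \<lceil>a' (d' (quantile N (cdf M r)))\<rceil> = \<lceil>r\<rceil>" by eventually_elim simp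
  from ae_iso_AE[OF iM this]
  have "AE x in \<mu>. e (d' (quantile N (cdf M (a x)))) = c x"
    by (simp add: ac ae)
  with ae_iso_trans[OF ae_iso_trans[OF iM iMN] iN] show ?thesis by (rule that)
qed

lemma ae_iso_exists:
  fixes \<mu> :: "'a::{complete_space,second_countable_topology} measure"
    and \<nu> :: "'b::{complete_space,second_countable_topology} measure"
  assumes \<mu>: "\<mu> \<in> Prob" "continuous_measure \<mu>" and \<nu>: "\<nu> \<in> Prob" "continuous_measure \<nu>"
  obtains f g where "ae_iso \<mu> \<nu> f g"
proof -
  \<comment> \<open>A constant label imposes no constraint.\<close>
  have "distr \<mu> (count_space UNIV) (\<lambda>_. 0::nat) = distr \<nu> (count_space UNIV) (\<lambda>_. 0)"
    using \<mu>(1) \<nu>(1) space_Prob[OF \<mu>(1)] space_Prob[OF \<nu>(1)]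
    by (intro measure_eqI)
       (auto simp: Prob_def emeasure_distr dest!: prob_space.emeasure_space_1)
  from ae_iso_labelled[OF \<mu> \<nu> _ _ this] show ?thesis using that by auto
qed

subsection \<open>Borel bijections from isomorphisms modulo null sets\<close>

text \<open>
  The quantile function of a probability concentrated on a closed set \<open>K\<close> takes values in \<open>K\<close>, so it
  embeds the line into a compact subset of the set where \<open>g \<circ> f\<close> is the identity.
\<close>

lemma real_embedding:
  fixes \<mu> :: "'a::{complete_space,second_countable_topology} measure"
  assumes \<mu>: "\<mu> \<in> Prob" "continuous_measure \<mu>"
  obtains j :: "real \<Rightarrow> 'a" and l :: "'a \<Rightarrow> real"
  where "j \<in> borel_measurable borel" and "l \<in> borel_measurable borel" and "\<And>r. l (j r) = r"
proof -
  interpret U: prob_space unif01 by (rule prob_space_unif01)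
  have U0: "emeasure unif01 {x} = 0" for x
    by (subst emeasure_uniform_measure) (auto simp: Int_insert_right)
  have "unif01 \<in> Prob" "continuous_measure unif01"
    using U0 by (auto simp: Prob_def continuous_measure_def prob_space_unif01)
  from ae_iso_exists[OF this \<mu>] obtain f g where fg: "ae_iso unif01 \<mu> f g" by blast
  then have [measurable]: "f \<in> borel_measurable borel" "g \<in> borel_measurable borel"
    by (auto simp: ae_iso_def)
  define B where "B = {u. g (f u) = u}"
  have B[measurable]: "B \<in> sets borel" unfolding B_def by measurable
  have "emeasure unif01 B = 1"
    by (rule U.emeasure_eq_1_AE) (use fg in \<open>auto simp: ae_iso_def B_def\<close>)
  \<comment> \<open>A compact subset of \<open>B\<close> with positive mass is enough:
    \<open>f\<close> is injective on it, and normalized restriction to it gives an atomless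
    law.\<close>
  moreover have "emeasure unif01 B = (SUP K \<in> {K. K \<subseteq> B \<and> compact K}. emeasure unif01 K)"
    by (rule inner_regular) (auto simp: U.emeasure_finite)
  ultimately obtain K where K: "K \<subseteq> B" "compact K" "0 < emeasure unif01 K"
    by (metis (no_types, lifting) less_SUP_iff mem_Collect_eq zero_less_one)
  have [measurable]: "K \<in> sets borel" using K by (simp add: borel_compact)
  define N where "N = uniform_measure unif01 K"
  have "prob_space N"
    unfolding N_def using K(3) U.emeasure_finite[of K]
    by (intro prob_space_uniform_measure) (simp_all only: less_le infinity_ennreal_def, auto)
  then have N: "real_distribution N"
    by (simp add: real_distribution_def real_distribution_axioms_def N_def)
  have "emeasure N {x} = 0" for x
  proof -
    have "emeasure unif01 (K \<inter> {x}) \<le> emeasure unif01 {x}" by (intro emeasure_mono) auto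
    then show ?thesis unfolding N_def by (subst emeasure_uniform_measure) (auto simp: U0)
  qed
  then have N0: "measure N {x} = 0" for x by (simp add: measure_def)
  have "emeasure N K = 1"
    unfolding N_def
    by (rule emeasure_uniform_measure_1) (use K(3) U.emeasure_finite[of K] in \<open>simp_all only: less_le, auto\<close>)
  then have NK: "measure N K = 1" by (simp add: measure_def)
  obtain a :: "real \<Rightarrow> real" and d where ad[measurable]: "a \<in> borel_measurable borel" "d \<in> borel_measurable borel"
    and da: "\<And>x. d (a x) = x" and a01: "\<And>x. 0 < a x" "\<And>x. a x < 1"
    using borel_code[where 'a = real] by blast
  note [measurable] = borel_measurable_quantile[OF N]
  have [measurable]: "cdf N \<in> borel_measurable borel"
    using ae_iso_quantile[OF N N0] by (simp add: ae_iso_def)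
  show ?thesis
  \<comment> \<open>A real is coded into (0, 1), sent by the quantile into \<open>K\<close>, then by
    \<open>f\<close> into the space; the left inverse undoes these maps in reverse order at every
    real.\<close>
  proof (rule that[of "\<lambda>r. f (quantile N (a r))" "\<lambda>x. d (cdf N (g x))"])
    fix r
    have "quantile N (a r) \<in> B"
      using quantile_in_closed[OF N compact_imp_closed[OF K(2)] NK a01] K(1) by blast
    then show "d (cdf N (g (f (quantile N (a r))))) = r"
      using cdf_quantile[OF N N0 a01] by (simp add: B_def da)
  qed measurable
qed

text \<open>
  Embed the plane: the images of its vertical lines are disjoint, so one of them is null.
\<close>

lemma null_real_embedding:
  fixes \<mu> :: "'a::{complete_space,second_countable_topology} measure"
  assumes \<mu>: "\<mu> \<in> Prob" "continuous_measure \<mu>"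
  obtains k :: "real \<Rightarrow> 'a" and l :: "'a \<Rightarrow> real" and S
  where "k \<in> borel_measurable borel" and "l \<in> borel_measurable borel" and "\<And>r. l (k r) = r"
    and "S \<in> sets borel" and "emeasure \<mu> S = 0" and "range k \<subseteq> S"
proof -
  have s[measurable_cong]: "sets \<mu> = sets borel" and "prob_space \<mu>"
    using \<mu> by (auto simp: Prob_def)
  interpret prob_space \<mu> by fact
  obtain j :: "real \<Rightarrow> 'a" and l where jl[measurable]: "j \<in> borel_measurable borel" "l \<in> borel_measurable borel"
    and lj: "\<And>r. l (j r) = r"
    using real_embedding[OF \<mu>] by blast
  obtain a :: "real \<times> real \<Rightarrow> real" and d where ad[measurable]: "a \<in> borel_measurable borel" "d \<in> borel_measurable borel"
    and da: "\<And>x. d (a x) = x" and "\<And>x. 0 < a x" "\<And>x. a x < 1"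
    using borel_code[where 'a = "real \<times> real"] by blast
  define h where "h = (\<lambda>x. fst (d (l x)))"
  have [measurable]: "h \<in> borel_measurable borel" unfolding h_def by measurable
  interpret D: prob_space "distr \<mu> borel h" by (rule prob_space_distr) simp
  \<comment> \<open>At most countably many values of \<open>h\<close> carry positive mass. The level
    set \<open>S\<close> of a value without mass contains the image of the vertical line over
    \<open>t\<close>.\<close>
  obtain t where t: "measure (distr \<mu> borel h) {t} = 0"
    using D.countable_support uncountable_UNIV_real
    by (metis (mono_tags, lifting) UNIV_eq_I mem_Collect_eq)
  define S where "S = {x. h x = t}"
  have [measurable]: "S \<in> sets borel" unfolding S_def by measurable
  have "measure \<mu> S = 0"
    using t by (subst (asm) measure_distr) (auto simp: S_def vimage_def sets_eq_imp_space_eq[OF s])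
  then have "emeasure \<mu> S = 0" by (simp add: emeasure_eq_measure)
  moreover have "(\<lambda>s. j (a (t, s))) \<in> borel_measurable borel"
    by measurable
  moreover have "(\<lambda>x. snd (d (l x))) \<in> borel_measurable borel"
    by measurable
  moreover have "range (\<lambda>s. j (a (t, s))) \<subseteq> S" by (auto simp: S_def h_def lj da)
  ultimately show ?thesis
    using that[of "\<lambda>s. j (a (t, s))" "\<lambda>x. snd (d (l x))" S] by (simp add: lj da)
qed

section \<open>Schroeder-Bernstein for Borel embeddings\<close>

lemma borel_image_embedding:
  fixes h :: "'a::topological_space \<Rightarrow> 'b::{second_countable_topology,t2_space}"
  assumes [measurable]: "h \<in> borel_measurable borel" "h' \<in> borel_measurable borel"
    and inv: "\<And>x. h' (h x) = x" and [measurable]: "B \<in> sets borel"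
  shows "h ` B \<in> sets borel"
proof -
  \<comment> \<open>A Borel left inverse describes the image by an equation and a preimage, both
    Borel.\<close>
  have "h ` B = {y. h (h' y) = y \<and> h' y \<in> B}" using inv by (auto simp: image_iff) metis
  also have "\<dots> \<in> sets borel" by measurable
  finally show ?thesis .
qed

text \<open>\<open>E\<close> collects the points whose backward orbit ends in \<open>P\<close>
  outside the image of \<open>Q\<close>; there \<open>f\<close> is used, elsewhere the inverse of
  \<open>g\<close>. Images under the embeddings are Borel, hence so is \<open>E\<close>.\<close>

lemma borel_Schroeder_Bernstein:
  fixes f :: "'a::{second_countable_topology,t2_space} \<Rightarrow> 'b::{second_countable_topology,t2_space}"
  assumes f: "f \<in> borel_measurable borel" "f' \<in> borel_measurable borel" "\<And>x. f' (f x) = x"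
    and g: "g \<in> borel_measurable borel" "g' \<in> borel_measurable borel" "\<And>y. g' (g y) = y"
    and P: "P \<in> sets borel" "g ` Q \<subseteq> P" and Q: "Q \<in> sets borel" "f ` P \<subseteq> Q"
  obtains h where "h \<in> borel_measurable borel" and "bij_betw h P Q"
proof -
  define E where "E = (\<Union>n. ((\<lambda>A. g ` f ` A) ^^ n) (P - g ` Q))"
  define h where "h = (\<lambda>x. if x \<in> E then f x else g' x)"
  have "((\<lambda>A. g ` f ` A) ^^ n) (P - g ` Q) \<in> sets borel" for n
    by (induction n) (use P Q in \<open>auto intro!: borel_image_embedding[OF f] borel_image_embedding[OF g]\<close>)
  then have E_sets[measurable]: "E \<in> sets borel" unfolding E_def by auto
  have "g ` f ` A \<subseteq> P" if "A \<subseteq> P" for A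
    using that P(2) Q(2) by blast
  then have "((\<lambda>A. g ` f ` A) ^^ n) (P - g ` Q) \<subseteq> P" for n
    by (induction n) auto
  then have EP: "E \<subseteq> P" unfolding E_def by blast
  have E_base: "x \<in> g ` Q" if "x \<in> P - E" for x
    using that unfolding E_def by (auto dest: spec[of _ 0])
  have E_step: "g (f x) \<in> E" if x: "x \<in> E" for x
  proof -
    obtain n where "x \<in> ((\<lambda>A. g ` f ` A) ^^ n) (P - g ` Q)" using x unfolding E_def by blast
    then have "g (f x) \<in> ((\<lambda>A. g ` f ` A) ^^ Suc n) (P - g ` Q)" by auto
    then show ?thesis unfolding E_def by blast
  qed
  have E_cases: "y \<in> f ` E" if y: "g y \<in> E" "y \<in> Q" for y
  proof -
    obtain n where n: "g y \<in> ((\<lambda>A. g ` f ` A) ^^ n) (P - g ` Q)" using y unfolding E_def by blast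
    \<comment> \<open>The index 0 is impossible, because \<open>g y\<close> lies in the image of
      \<open>Q\<close>.\<close>
    with y(2) obtain m where "n = Suc m" by (cases n) auto
    with n obtain x where x: "x \<in> ((\<lambda>A. g ` f ` A) ^^ m) (P - g ` Q)" "g y = g (f x)" by auto
    then have "y = f x" using g(3) by metis
    then show ?thesis using x(1) unfolding E_def by blast
  qed
  have "h \<in> borel_measurable borel" unfolding h_def using f(1) g(2) by measurable
  moreover have "bij_betw h P Q"
  proof (rule bij_betw_imageI)
    have ne: "f x \<noteq> g' x'" if "x \<in> E" "x' \<in> P - E" for x x'
      using E_base[OF that(2)] E_step[OF that(1)] that g(3) by auto
    have inj_g': "x = x'" if "x \<in> P - E" "x' \<in> P - E" "g' x = g' x'" for x x'
      using E_base[OF that(1)] E_base[OF that(2)] that(3) g(3) by auto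
    show "inj_on h P"
    proof (rule inj_onI)
      fix x x' assume *: "x \<in> P" "x' \<in> P" "h x = h x'"
      show "x = x'"
        using * ne[of x x'] ne[of x' x] inj_g'[of x x'] f(3)
        by (cases "x \<in> E"; cases "x' \<in> E") (simp_all add: h_def, metis+)
    qed
    show "h ` P = Q"
    proof (intro equalityI subsetI)
      fix y assume "y \<in> h ` P"
      then obtain x where x: "x \<in> P" "y = h x" by blast
      show "y \<in> Q"
        using x Q(2) E_base[of x] g(3) by (cases "x \<in> E") (auto simp: h_def)
    next
      fix y assume y: "y \<in> Q"
      show "y \<in> h ` P"
      proof (cases "g y \<in> E")
        case True
        then show ?thesis using E_cases[OF True y] EP by (auto simp: h_def)
      next
        case False
        then have "h (g y) = y" by (simp add: h_def g(3))
        then show ?thesis using y P(2) by (metis image_eqI image_subset_iff)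
      qed
    qed
  qed
  ultimately show ?thesis by (rule that)
qed

text \<open>Null copies of the line are moved to the exceptional sets on both sides. Each
  exceptional set then admits a Borel embedding of the whole other space, through its real code, and
  the two sets can be matched.\<close>

lemma borel_bij_of_ae_iso:
  fixes \<mu> :: "'a::{complete_space,second_countable_topology} measure"
    and \<nu> :: "'b::{complete_space,second_countable_topology} measure"
  assumes \<mu>: "\<mu> \<in> Prob" "continuous_measure \<mu>" and \<nu>: "\<nu> \<in> Prob" "continuous_measure \<nu>"
    and iso: "ae_iso \<mu> \<nu> \<phi> \<psi>"
  obtains T where "bij T" and "T \<in> borel_measurable borel" and "AE x in \<mu>. T x = \<phi> x"
proof -
  have [measurable]: "\<phi> \<in> borel_measurable borel" "\<psi> \<in> borel_measurable borel"
    using iso by (auto simp: ae_iso_def)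
  have s: "sets \<mu> = sets borel" "sets \<nu> = sets borel" using \<mu> \<nu> by (auto simp: Prob_def)
  obtain a :: "'a \<Rightarrow> real" and d where a[measurable]: "a \<in> borel_measurable borel" "d \<in> borel_measurable borel"
    and da: "\<And>x. d (a x) = x" and "\<And>x. 0 < a x" "\<And>x. a x < 1"
    using borel_code[where 'a = 'a] by blast
  obtain b :: "'b \<Rightarrow> real" and e where b[measurable]: "b \<in> borel_measurable borel" "e \<in> borel_measurable borel"
    and eb: "\<And>x. e (b x) = x" and "\<And>x. 0 < b x" "\<And>x. b x < 1"
    using borel_code[where 'a = 'b] by blast
  obtain k :: "real \<Rightarrow> 'a" and l S where k[measurable]: "k \<in> borel_measurable borel" "l \<in> borel_measurable borel"
    and lk: "\<And>r. l (k r) = r" and S[measurable]: "S \<in> sets borel" and S0: "emeasure \<mu> S = 0" "range k \<subseteq> S"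
    using null_real_embedding[OF \<mu>] by blast
  obtain k' :: "real \<Rightarrow> 'b" and l' S' where k'[measurable]: "k' \<in> borel_measurable borel" "l' \<in> borel_measurable borel"
    and lk': "\<And>r. l' (k' r) = r" and S'[measurable]: "S' \<in> sets borel" and S0': "emeasure \<nu> S' = 0" "range k' \<subseteq> S'"
    using null_real_embedding[OF \<nu>] by blast
  \<comment> \<open>The two conditions mirror each other, so that \<open>\<phi>\<close> maps
    \<open>A\<close> onto \<open>B\<close> with inverse \<open>\<psi>\<close>, while the complements
    contain \<open>S\<close> and \<open>S'\<close>.\<close>
  define A where "A = {x. \<psi> (\<phi> x) = x \<and> x \<notin> S \<and> \<phi> x \<notin> S'}"
  define B where "B = {y. \<phi> (\<psi> y) = y \<and> y \<notin> S' \<and> \<psi> y \<notin> S}"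
  have AB[measurable]: "A \<in> sets borel" "B \<in> sets borel" unfolding A_def B_def by measurable
  obtain h where h[measurable]: "h \<in> borel_measurable borel" and bij_h: "bij_betw h (- A) (- B)"
  proof (rule borel_Schroeder_Bernstein[of "\<lambda>x. k' (a x)" "\<lambda>y. d (l' y)" "\<lambda>y. k (b y)" "\<lambda>x. e (l x)" "- A" "- B"])
    show "- A \<in> sets borel" "- B \<in> sets borel" using AB by auto
    show "(\<lambda>y. k (b y)) ` (- B) \<subseteq> - A" using S0(2) by (auto simp: A_def)
    show "(\<lambda>x. k' (a x)) ` (- A) \<subseteq> - B" using S0'(2) by (auto simp: B_def)
  qed (simp_all add: lk lk' da eb)
  define T where "T = (\<lambda>x. if x \<in> A then \<phi> x else h x)"
  have "bij_betw \<phi> A B"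
    by (rule bij_betw_byWitness[of _ \<psi>]) (auto simp: A_def B_def)
  then have 1: "bij_betw T A B" by (subst bij_betw_cong[of A T \<phi>]) (auto simp: T_def)
  have 2: "bij_betw T (- A) (- B)" using bij_h by (subst bij_betw_cong[of "- A" T h]) (auto simp: T_def)
  have "bij T" using bij_betw_combine[OF 1 2] by simp
  moreover have "T \<in> borel_measurable borel" unfolding T_def by measurable
  moreover have "AE x in \<mu>. T x = \<phi> x"
  proof -
    have 1: "AE x in \<mu>. x \<notin> S" and 2: "AE y in \<nu>. y \<notin> S'"
      using S S' S0(1) S0'(1) s by (auto intro!: AE_not_in simp: null_sets_def)
    have "AE x in \<mu>. \<psi> (\<phi> x) = x" using iso by (simp add: ae_iso_def)
    with 1 ae_iso_AE[OF iso 2] show ?thesis by eventually_elim (simp add: T_def A_def)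
  qed
  ultimately show ?thesis by (rule that)
qed

subsection \<open>Approximation of couplings\<close>

text \<open>By Lindelof, countably many balls of radius \<open>\<delta> / 2\<close> cover the space;
  the label of a point is the index of the first ball containing it.\<close>

lemma compatible_metric_cells:
  fixes d :: "'a::second_countable_topology \<Rightarrow> 'a \<Rightarrow> real"
  assumes d: "compatible_metric d" and "\<delta> > 0"
  obtains c :: "'a \<Rightarrow> nat" where "c \<in> measurable borel (count_space UNIV)"
    and "\<And>x y. c x = c y \<Longrightarrow> d x y < \<delta>"
proof -
  interpret Metric_space UNIV d using d by (simp add: compatible_metric_def)
  have top: "mtopology = euclidean" using d by (simp add: compatible_metric_def)
  define F where "F = range (\<lambda>x. mball x (\<delta> / 2))"
  have F_open: "open S" if "S \<in> F" for S
    using that openin_mball unfolding top F_def by auto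
  obtain F' where F': "F' \<subseteq> F" "countable F'" "\<Union>F' = \<Union>F"
    using Lindelof[OF F_open] by metis
  have "\<Union>F = UNIV" using \<open>\<delta> > 0\<close> by (auto simp: F_def)
  define B where "B = from_nat_into F'"
  have "F' \<noteq> {}" using F'(3) \<open>\<Union>F = UNIV\<close> by auto
  then have rB: "range B = F'" unfolding B_def using F'(2) by (rule range_from_nat_into)
  have [measurable]: "B n \<in> sets borel" for n
    using rB F'(1) F_open by (intro borel_open) blast
  define c where "c = (\<lambda>x. LEAST n. x \<in> B n)"
  have c: "x \<in> B (c x)" for x
  proof -
    have "x \<in> \<Union>(range B)" using rB F'(3) \<open>\<Union>F = UNIV\<close> by simp
    then have "\<exists>n. x \<in> B n" by simp
    then show ?thesis unfolding c_def by (rule LeastI_ex)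
  qed
  show ?thesis
  proof (rule that[of c])
    show "c \<in> measurable borel (count_space UNIV)" unfolding c_def by measurable
    fix x y assume eq: "c x = c y"
    have "B (c x) \<in> F" using rB F'(1) by blast
    then obtain z where "B (c x) = mball z (\<delta> / 2)" unfolding F_def by blast
    then have "d z x < \<delta> / 2" "d z y < \<delta> / 2" using c[of x] c[of y] eq by auto
    then show "d x y < \<delta>" using triangle[of x z y] commute[of x z] by auto
  qed
qed

text \<open>A point lies in a fibre of the first projection, whose mass is that of a point under
  \<open>\<mu>\<close>.\<close>

lemma Cpl_continuous_measure:
  fixes \<mu> :: "'a::{second_countable_topology,t2_space} measure" and \<nu> :: "'b::{second_countable_topology,t2_space} measure"
  assumes "\<gamma> \<in> Cpl \<mu> \<nu>" and "continuous_measure \<mu>"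
  shows "continuous_measure \<gamma>"
  unfolding continuous_measure_def
proof
  fix z
  have [measurable_cong]: "sets \<gamma> = sets borel" and \<mu>: "\<mu> = distr \<gamma> borel fst"
    using assms by (auto simp: Cpl_def Prob_def)
  have "emeasure \<gamma> {z} \<le> emeasure \<gamma> (fst -` {fst z} \<inter> space \<gamma>)"
    using sets_eq_imp_space_eq[OF \<open>sets \<gamma> = sets borel\<close>]
    by (intro emeasure_mono measurable_sets[of _ _ borel]) auto
  also have "\<dots> = emeasure \<mu> {fst z}"
    unfolding \<mu> by (rule emeasure_distr[symmetric]) auto
  finally show "emeasure \<gamma> {z} = 0" using assms(2) by (simp add: continuous_measure_def)
qed

text \<open>A single coupling with almost sure bounds on both displacements serves weak density and
  density in the transport distance alike.\<close>

proposition Cpl_biM_approx: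
  fixes \<mu> :: "'a::polish_space measure" and \<nu> :: "'b::polish_space measure"
  assumes \<mu>: "\<mu> \<in> Prob" "continuous_measure \<mu>" and \<nu>: "\<nu> \<in> Prob" "continuous_measure \<nu>"
    and dX: "compatible_metric dX" and dY: "compatible_metric dY"
    and \<gamma>: "\<gamma> \<in> Cpl \<mu> \<nu>" and \<delta>: "\<delta> > 0"
  obtains \<eta> \<pi> where "\<eta> \<in> Cpl_biM \<mu> \<nu>" and "\<pi> \<in> Cpl \<gamma> \<eta>"
    and "AE zw in \<pi>. dX (fst (fst zw)) (fst (snd zw)) < \<delta> \<and> dY (snd (fst zw)) (snd (snd zw)) < \<delta>"
proof -
  have s[measurable_cong]: "sets \<mu> = sets borel" "sets \<nu> = sets borel" "sets \<gamma> = sets borel"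
    and \<gamma>_marg: "\<mu> = distr \<gamma> borel fst" "\<nu> = distr \<gamma> borel snd"
    using \<mu> \<nu> \<gamma> by (auto simp: Prob_def Cpl_def)
  have \<gamma>P: "\<gamma> \<in> Prob" "continuous_measure \<gamma>"
    using \<gamma> Cpl_continuous_measure[OF \<gamma> \<mu>(2)] by (auto simp: Cpl_def)
  obtain c :: "'a \<Rightarrow> nat" where c[measurable]: "c \<in> measurable borel (count_space UNIV)"
    and cd: "\<And>x y. c x = c y \<Longrightarrow> dX x y < \<delta>"
    using compatible_metric_cells[OF dX \<delta>] by blast
  obtain e :: "'b \<Rightarrow> nat" where e[measurable]: "e \<in> measurable borel (count_space UNIV)"
    and ed: "\<And>x y. e x = e y \<Longrightarrow> dY x y < \<delta>"
    using compatible_metric_cells[OF dY \<delta>] by blast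
  have cf[measurable]: "(\<lambda>z. c (fst z)) \<in> measurable borel (count_space UNIV)"
    and es[measurable]: "(\<lambda>z. e (snd z)) \<in> measurable borel (count_space UNIV)"
    by measurable
  have "distr \<mu> (count_space UNIV) c = distr \<gamma> (count_space UNIV) (\<lambda>z. c (fst z))"
    unfolding \<gamma>_marg by (subst distr_distr) (auto simp: comp_def)
  from ae_iso_labelled[OF \<mu> \<gamma>P c cf this] obtain \<phi> \<phi>'
    where \<phi>: "ae_iso \<mu> \<gamma> \<phi> \<phi>'" "AE x in \<mu>. c (fst (\<phi> x)) = c x" by blast
  have "distr \<gamma> (count_space UNIV) (\<lambda>z. e (snd z)) = distr \<nu> (count_space UNIV) e"
    unfolding \<gamma>_marg by (subst distr_distr) (auto simp: comp_def)
  from ae_iso_labelled[OF \<gamma>P \<nu> es e this] obtain \<psi> \<psi>'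
    where \<psi>: "ae_iso \<gamma> \<nu> \<psi> \<psi>'" "AE z in \<gamma>. e (\<psi> z) = e (snd z)" by blast
  note iso = ae_iso_trans[OF \<phi>(1) \<psi>(1)]
  obtain T where T: "bij T" "AE x in \<mu>. T x = \<psi> (\<phi> x)" and Tm[measurable]: "T \<in> borel_measurable borel"
    using borel_bij_of_ae_iso[OF \<mu> \<nu> iso] by blast
  have [measurable]: "\<phi> \<in> borel_measurable borel" "\<psi> \<in> borel_measurable borel"
    and d\<phi>: "distr \<mu> borel \<phi> = \<gamma>" and d\<psi>\<phi>: "distr \<mu> borel (\<lambda>x. \<psi> (\<phi> x)) = \<nu>"
    using \<phi>(1) \<psi>(1) iso by (auto simp: ae_iso_def)
  have "distr \<mu> borel T = distr \<mu> borel (\<lambda>x. \<psi> (\<phi> x))"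
    by (rule distr_cong_AE) (use T in auto)
  then have dT: "distr \<mu> borel T = \<nu>" using d\<psi>\<phi> by simp
  define \<eta> where "\<eta> = distr \<mu> borel (\<lambda>x. (x, T x))"
  define \<pi> where "\<pi> = distr \<mu> borel (\<lambda>x. (\<phi> x, (x, T x)))"
  have [measurable]: "(\<lambda>x. (\<phi> x, (x, T x))) \<in> measurable borel borel"
    by measurable
  have "prob_space \<mu>" using \<mu> by (simp add: Prob_def)
  then have "\<pi> \<in> Prob"
    unfolding \<pi>_def by (auto simp: Prob_def intro!: prob_space.prob_space_distr)
  moreover have "distr \<pi> borel fst = \<gamma>" "distr \<pi> borel snd = \<eta>"
    unfolding \<pi>_def \<eta>_def d\<phi>[symmetric] by (subst distr_distr; simp add: comp_def)+
  ultimately have "\<pi> \<in> Cpl \<gamma> \<eta>" by (simp add: Cpl_def)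
  moreover have "\<eta> \<in> Cpl_biM \<mu> \<nu>" unfolding Cpl_biM_def \<eta>_def using T(1) dT Tm by blast
  \<comment> \<open>Equality of labels defines a Borel set, so it can be transferred from
    \<open>\<mu>\<close> to \<open>\<pi>\<close>; the metric bounds then follow pointwise.\<close>
  moreover have "AE zw in \<pi>. c (fst (fst zw)) = c (fst (snd zw)) \<and> e (snd (fst zw)) = e (snd (snd zw))"
  proof -
    have "AE x in \<mu>. e (\<psi> (\<phi> x)) = e (snd (\<phi> x))" by (rule ae_iso_AE[OF \<phi>(1) \<psi>(2)])
    with T(2) \<phi>(2) have "AE x in \<mu>. c (fst (\<phi> x)) = c x \<and> e (snd (\<phi> x)) = e (T x)"
      by eventually_elim simp
    moreover have "{zw. c (fst (fst zw)) = c (fst (snd zw)) \<and> e (snd (fst zw)) = e (snd (snd zw))} \<in> sets borel"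
    proof -
      have [measurable]: "(\<lambda>z::'a \<times> 'b. real (c (fst z))) \<in> borel_measurable borel"
        "(\<lambda>z::'a \<times> 'b. real (e (snd z))) \<in> borel_measurable borel"
        by measurable
      have "{zw :: ('a \<times> 'b) \<times> 'a \<times> 'b. real (c (fst (fst zw))) = real (c (fst (snd zw))) \<and>
          real (e (snd (fst zw))) = real (e (snd (snd zw)))} \<in> sets borel"
        by measurable
      then show ?thesis by simp
    qed
    ultimately show ?thesis
      unfolding \<pi>_def by (subst AE_distr_iff) simp_all
  qed
  then have "AE zw in \<pi>. dX (fst (fst zw)) (fst (snd zw)) < \<delta> \<and> dY (snd (fst zw)) (snd (snd zw)) < \<delta>"
    by eventually_elim (use cd ed in blast)
  ultimately show ?thesis using that by blast
qed

subsection \<open>Weak convergence\<close>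

text \<open>A modulus of continuity that depends on the point, since the test functions need not be
  uniformly continuous.\<close>

definition oscillation :: "('a::metric_space \<times> 'b::metric_space \<Rightarrow> real) \<Rightarrow> real \<Rightarrow> 'a \<times> 'b \<Rightarrow> real" where
  "oscillation f \<delta> z = (SUP w\<in>{w. dist (fst z) (fst w) < \<delta> \<and> dist (snd z) (snd w) < \<delta>}. \<bar>f z - f w\<bar>)"

context
  fixes f :: "'a::metric_space \<times> 'b::metric_space \<Rightarrow> real" and B :: real
  assumes bounded: "\<And>z. \<bar>f z\<bar> \<le> B"
begin

lemma bdd_above_oscillation: "bdd_above ((\<lambda>w. \<bar>f z - f w\<bar>) ` A)"
proof (rule bdd_aboveI2)
  show "\<bar>f z - f w\<bar> \<le> 2 * B" for w using bounded[of z] bounded[of w] by linarith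
qed

lemma oscillation_ge:
  "dist (fst z) (fst w) < \<delta> \<Longrightarrow> dist (snd z) (snd w) < \<delta> \<Longrightarrow> \<bar>f z - f w\<bar> \<le> oscillation f \<delta> z"
  unfolding oscillation_def by (intro cSUP_upper bdd_above_oscillation) simp

lemma oscillation_leI:
  assumes "\<delta> > 0" and "\<And>w. dist (fst z) (fst w) < \<delta> \<Longrightarrow> dist (snd z) (snd w) < \<delta> \<Longrightarrow> \<bar>f z - f w\<bar> \<le> C"
  shows "oscillation f \<delta> z \<le> C"
  unfolding oscillation_def using assms by (intro cSUP_least) (auto intro!: exI[of _ "fst z"] exI[of _ "snd z"])

lemma oscillation_bounds:
  assumes "\<delta> > 0"
  shows "0 \<le> oscillation f \<delta> z" and "oscillation f \<delta> z \<le> 2 * B"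
proof -
  show "0 \<le> oscillation f \<delta> z" using oscillation_ge[of z z \<delta>] assms by simp
  show "oscillation f \<delta> z \<le> 2 * B"
  proof (rule oscillation_leI[OF assms])
    show "\<bar>f z - f w\<bar> \<le> 2 * B" for w using bounded[of z] bounded[of w] by linarith
  qed
qed

text \<open>Superlevel sets are unions over \<open>w\<close> of open sets. The union is uncountable,
  so it is openness that gives measurability.\<close>

lemma borel_measurable_oscillation:
  assumes f: "continuous_on UNIV f" and \<delta>: "\<delta> > 0"
  shows "oscillation f \<delta> \<in> borel_measurable borel"
  unfolding borel_measurable_iff_greater
proof
  fix a
  have "{z. a < oscillation f \<delta> z} =
    (\<Union>w. {z. a < \<bar>f z - f w\<bar>} \<inter> {z. dist (fst z) (fst w) < \<delta>} \<inter> {z. dist (snd z) (snd w) < \<delta>})"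
  proof -
    have "z \<in> {w. dist (fst z) (fst w) < \<delta> \<and> dist (snd z) (snd w) < \<delta>}" for z :: "'a \<times> 'b"
      using \<delta> by simp
    then have "a < oscillation f \<delta> z \<longleftrightarrow>
        (\<exists>w\<in>{w. dist (fst z) (fst w) < \<delta> \<and> dist (snd z) (snd w) < \<delta>}. a < \<bar>f z - f w\<bar>)" for z
      unfolding oscillation_def by (intro less_cSUP_iff bdd_above_oscillation) blast
    then show ?thesis
      by blast
  qed
  also have "open \<dots>"
    by (intro open_UN open_Int open_Collect_less continuous_intros f ballI)
  finally show "{z \<in> space borel. a < oscillation f \<delta> z} \<in> sets borel" by (simp add: borel_open)
qed

lemma oscillation_tendsto_0:
  assumes f: "continuous_on UNIV f" and \<delta>: "\<delta> \<longlonglongrightarrow> 0" "\<And>n. \<delta> n > 0"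
  shows "(\<lambda>n. oscillation f (\<delta> n) z) \<longlonglongrightarrow> 0"
proof (rule tendstoI)
  fix \<epsilon> :: real assume \<epsilon>: "\<epsilon> > 0"
  obtain r where r: "r > 0" "\<And>w. dist w z < r \<Longrightarrow> \<bar>f w - f z\<bar> < \<epsilon> / 2"
    using f \<epsilon> unfolding continuous_on_iff dist_real_def by (metis UNIV_I half_gt_zero)
  \<comment> \<open>The product distance is at most the sum of the coordinate distances, so half of
    \<open>r\<close> for each coordinate suffices.\<close>
  have "eventually (\<lambda>n. \<delta> n < r / 2) sequentially"
    using \<delta>(1) r(1) by (intro order_tendstoD) auto
  then show "eventually (\<lambda>n. dist (oscillation f (\<delta> n) z) 0 < \<epsilon>) sequentially"
  proof eventually_elim
    case (elim n)
    have "oscillation f (\<delta> n) z \<le> \<epsilon> / 2"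
    proof (rule oscillation_leI[OF \<delta>(2)])
      fix w assume w: "dist (fst z) (fst w) < \<delta> n" "dist (snd z) (snd w) < \<delta> n"
      have "dist z w \<le> dist (fst z) (fst w) + dist (snd z) (snd w)"
        unfolding dist_prod_def by (rule sqrt_sum_squares_le_sum) auto
      then have "dist w z < r" using w elim by (simp add: dist_commute)
      then show "\<bar>f z - f w\<bar> \<le> \<epsilon> / 2" using r(2)[of w] by linarith
    qed
    then show ?case using oscillation_bounds(1)[OF \<delta>(2), of n z] \<epsilon> by simp
  qed
qed

end

lemma Cpl_integral:
  fixes f :: "'a::second_countable_topology \<Rightarrow> real"
  assumes "\<pi> \<in> Cpl \<alpha> \<beta>" and [measurable]: "f \<in> borel_measurable borel"
  shows "integral\<^sup>L \<alpha> f = (\<integral>zw. f (fst zw) \<partial>\<pi>)" and "integral\<^sup>L \<beta> f = (\<integral>zw. f (snd zw) \<partial>\<pi>)"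
proof -
  have [measurable_cong]: "sets \<pi> = sets borel" and m: "\<alpha> = distr \<pi> borel fst" "\<beta> = distr \<pi> borel snd"
    using assms(1) by (auto simp: Cpl_def Prob_def)
  show "integral\<^sup>L \<alpha> f = (\<integral>zw. f (fst zw) \<partial>\<pi>)" unfolding m by (rule integral_distr) auto
  show "integral\<^sup>L \<beta> f = (\<integral>zw. f (snd zw) \<partial>\<pi>)" unfolding m by (rule integral_distr) auto
qed

text \<open>Almost surely \<open>f\<close> changes by at most its oscillation at the first point,
  whose law is \<open>\<gamma>\<close> for all \<open>n\<close>. The integrals of the oscillations
  vanish by dominated convergence, with a constant bound.\<close>

lemma weak_convergence_of_close_couplings:
  fixes f :: "'a::{metric_space,second_countable_topology} \<times> 'b::{metric_space,second_countable_topology} \<Rightarrow> real"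
  assumes f: "continuous_on UNIV f" "bounded (range f)" and \<gamma>: "\<gamma> \<in> Prob"
    and \<delta>: "\<delta> \<longlonglongrightarrow> 0" "\<And>n. \<delta> n > 0" and \<pi>: "\<And>n. \<pi> n \<in> Cpl \<gamma> (\<eta> n)"
    and close: "\<And>n. AE zw in \<pi> n. dist (fst (fst zw)) (fst (snd zw)) < \<delta> n \<and> dist (snd (fst zw)) (snd (snd zw)) < \<delta> n"
  shows "(\<lambda>n. integral\<^sup>L (\<eta> n) f) \<longlonglongrightarrow> integral\<^sup>L \<gamma> f"
proof -
  obtain B where B: "\<And>z. \<bar>f z\<bar> \<le> B" using f(2) by (auto simp: bounded_iff)
  have [measurable]: "f \<in> borel_measurable borel" by (rule borel_measurable_continuous_onI[OF f(1)])
  note om[measurable] = borel_measurable_oscillation[where f = f and B = B, OF B f(1) \<delta>(2)]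
  note ob = oscillation_bounds[where f = f and B = B, OF B \<delta>(2)]
  have s\<gamma>: "sets \<gamma> = sets borel" "prob_space \<gamma>" using \<gamma> by (auto simp: Prob_def)
  interpret \<gamma>: prob_space \<gamma> by fact
  have bound: "\<bar>integral\<^sup>L (\<eta> n) f - integral\<^sup>L \<gamma> f\<bar> \<le> integral\<^sup>L \<gamma> (oscillation f (\<delta> n))" for n
  proof -
    have sp[measurable_cong]: "sets (\<pi> n) = sets borel" and "prob_space (\<pi> n)"
      using \<pi>[of n] by (auto simp: Cpl_def Prob_def)
    interpret \<pi>: prob_space "\<pi> n" by fact
    have int: "integrable (\<pi> n) (\<lambda>zw. f (fst zw))" "integrable (\<pi> n) (\<lambda>zw. f (snd zw))"
      using B by (auto intro!: \<pi>.integrable_const_bound[of _ B])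
    have io: "integrable (\<pi> n) (\<lambda>zw. oscillation f (\<delta> n) (fst zw))"
      using ob by (intro \<pi>.integrable_const_bound[of _ "2 * B"]) auto
    have "\<bar>integral\<^sup>L (\<eta> n) f - integral\<^sup>L \<gamma> f\<bar> = \<bar>\<integral>zw. f (fst zw) - f (snd zw) \<partial>\<pi> n\<bar>"
      by (simp add: Cpl_integral[OF \<pi>[of n]] int)
    also have "\<dots> \<le> (\<integral>zw. \<bar>f (fst zw) - f (snd zw)\<bar> \<partial>\<pi> n)" by (rule integral_abs_bound)
    also have "\<dots> \<le> (\<integral>zw. oscillation f (\<delta> n) (fst zw) \<partial>\<pi> n)"
    proof (rule integral_mono_AE)
      show "AE zw in \<pi> n. \<bar>f (fst zw) - f (snd zw)\<bar> \<le> oscillation f (\<delta> n) (fst zw)"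
        using close[of n] by eventually_elim (auto intro: oscillation_ge[where f = f and B = B, OF B])
    qed (use int io in auto)
    also have "\<dots> = integral\<^sup>L \<gamma> (oscillation f (\<delta> n))"
      by (rule Cpl_integral(1)[OF \<pi> om, symmetric])
    finally show ?thesis .
  qed
  have lim: "(\<lambda>n. integral\<^sup>L \<gamma> (oscillation f (\<delta> n))) \<longlonglongrightarrow> integral\<^sup>L \<gamma> (\<lambda>_. 0)"
  proof (rule integral_dominated_convergence[where w = "\<lambda>_. 2 * B"])
    show "AE z in \<gamma>. (\<lambda>n. oscillation f (\<delta> n) z) \<longlonglongrightarrow> 0"
      using oscillation_tendsto_0[where f = f and B = B, OF B f(1) \<delta>] by simp
    show "AE z in \<gamma>. norm (oscillation f (\<delta> n) z) \<le> 2 * B" for n using ob by simp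
    show "oscillation f (\<delta> n) \<in> borel_measurable \<gamma>" for n using om[of n] s\<gamma> by (simp cong: measurable_cong_sets)
  qed auto
  have "(\<lambda>n. integral\<^sup>L (\<eta> n) f - integral\<^sup>L \<gamma> f) \<longlonglongrightarrow> 0"
  proof (rule Lim_null_comparison)
    show "eventually (\<lambda>n. norm (integral\<^sup>L (\<eta> n) f - integral\<^sup>L \<gamma> f)
        \<le> integral\<^sup>L \<gamma> (oscillation f (\<delta> n))) sequentially"
      using bound by simp
    show "(\<lambda>n. integral\<^sup>L \<gamma> (oscillation f (\<delta> n))) \<longlonglongrightarrow> 0" using lim by simp
  qed
  then show ?thesis by (simp add: LIM_zero_iff)
qed

section \<open>Neighbourhoods in the weak topology and the density theorem\<close>

lemma compatible_metric_dist: "compatible_metric (dist :: 'a::metric_space \<Rightarrow> 'a \<Rightarrow> real)"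
  unfolding compatible_metric_def using Met_TC.Metric_space_axioms mtopology_is_euclidean by auto

text \<open>Convergence against test functions settles the subbasic sets; finite intersections and
  unions preserve eventual membership.\<close>

lemma weak_topology_eventually:
  assumes "generate_topology_on
     {{\<gamma> \<in> Prob. integral\<^sup>L \<gamma> f \<in> U} | f U.
        continuous_on UNIV f \<and> bounded (range f) \<and> open (U :: real set)} W"
    and "\<gamma> \<in> W" and "\<And>n. \<eta> n \<in> Prob"
    and "\<And>f. continuous_on UNIV f \<Longrightarrow> bounded (range f) \<Longrightarrow>
      (\<lambda>n. integral\<^sup>L (\<eta> n) f :: real) \<longlonglongrightarrow> integral\<^sup>L \<gamma> f"
  shows "eventually (\<lambda>n. \<eta> n \<in> W) sequentially"
  using assms(1,2)
proof (induction rule: generate_topology_on.induct)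
  case (Int a b)
  then show ?case by (auto intro: eventually_conj)
next
  case (UN K)
  then obtain k where "k \<in> K" "\<gamma> \<in> k" by blast
  with UN.IH[of k] show ?case by (auto elim: eventually_mono)
next
  case (Basis s)
  then obtain f and U :: "real set" where s: "s = {\<gamma> \<in> Prob. integral\<^sup>L \<gamma> f \<in> U}"
    and f: "continuous_on UNIV f" "bounded (range f)" and U: "open U" by blast
  have "eventually (\<lambda>n. integral\<^sup>L (\<eta> n) f \<in> U) sequentially"
    using assms(4)[OF f] U Basis.prems s by (auto simp: tendsto_def)
  then show ?case using assms(3) by (simp add: s)
qed simp

lemma topspace_weak_topology: "topspace weak_topology = Prob"
proof -
  have "Prob \<in> {{\<gamma> \<in> Prob. integral\<^sup>L \<gamma> f \<in> U} | f U.
        continuous_on UNIV f \<and> bounded (range f) \<and> open (U :: real set)}"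
    \<comment> \<open>The zero test function with \<open>U = UNIV\<close> makes \<open>Prob\<close>
      itself subbasic.\<close>
    by (rule CollectI, rule exI[of _ "\<lambda>_. 0"], rule exI[of _ UNIV]) (auto simp: image_def)
  then show ?thesis unfolding weak_topology_def topology_generated_by_topspace by blast
qed

theorem theorem2p6:
  fixes \<mu> :: "'a::polish_space measure" and \<nu> :: "'b::polish_space measure"
  assumes "\<mu> \<in> Prob" and "\<nu> \<in> Prob"
    and "continuous_measure \<mu>" and "continuous_measure \<nu>"
  shows "Cpl \<mu> \<nu> \<subseteq> weak_topology closure_of Cpl_biM \<mu> \<nu> \<and>
    (\<forall>(p::real) dX dY. 1 \<le> p \<longrightarrow> compatible_metric dX \<longrightarrow> compatible_metric dY
        \<longrightarrow> finite_moment dX p \<mu> \<longrightarrow> finite_moment dY p \<nu>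
        \<longrightarrow> (\<forall>\<gamma>\<in>Cpl \<mu> \<nu>. \<forall>\<epsilon>>0. \<exists>\<eta>\<in>Cpl_biM \<mu> \<nu>.
                Wpp (prod_dist_p dX dY p) \<gamma> \<eta> < ennreal \<epsilon>))"
proof (intro conjI subsetI allI impI ballI)
  note approx = Cpl_biM_approx[OF assms(1,3,2,4)]
  fix \<gamma> assume \<gamma>: "\<gamma> \<in> Cpl \<mu> \<nu>"
  then have \<gamma>P: "\<gamma> \<in> Prob" by (simp add: Cpl_def)
  define \<delta> :: "nat \<Rightarrow> real" where "\<delta> = (\<lambda>n. inverse (real (Suc n)))"
  have \<delta>: "\<delta> n > 0" for n by (simp add: \<delta>_def)
  have "\<forall>n. \<exists>\<eta> \<pi>. \<eta> \<in> Cpl_biM \<mu> \<nu> \<and> \<pi> \<in> Cpl \<gamma> \<eta> \<and>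
    (AE zw in \<pi>. dist (fst (fst zw)) (fst (snd zw)) < \<delta> n \<and> dist (snd (fst zw)) (snd (snd zw)) < \<delta> n)" (is "\<forall>n. ?P n")
  proof
    fix n
    \<comment> \<open>Weak density is independent of the choice of metrics, so the metrics of the
      type class are used.\<close>
    from approx[OF compatible_metric_dist compatible_metric_dist \<gamma> \<delta>[of n]]
    show "?P n" by blast
  qed
  from this[unfolded choice_iff] obtain \<eta> \<pi> where \<eta>: "\<And>n. \<eta> n \<in> Cpl_biM \<mu> \<nu>" and \<pi>: "\<And>n. \<pi> n \<in> Cpl \<gamma> (\<eta> n)"
    and close: "\<And>n. AE zw in \<pi> n. dist (fst (fst zw)) (fst (snd zw)) < \<delta> n \<and> dist (snd (fst zw)) (snd (snd zw)) < \<delta> n"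
    by blast
  have \<eta>P: "\<eta> n \<in> Prob" for n
    using \<eta>[of n] assms(1)
    by (auto simp: Cpl_biM_def Prob_def intro!: prob_space.prob_space_distr cong: measurable_cong_sets)
  have lim: "(\<lambda>n. integral\<^sup>L (\<eta> n) f) \<longlonglongrightarrow> integral\<^sup>L \<gamma> f"
    if "continuous_on UNIV f" "bounded (range f)" for f :: "'a \<times> 'b \<Rightarrow> real"
    by (rule weak_convergence_of_close_couplings[OF that \<gamma>P _ \<delta> \<pi> close])
       (unfold \<delta>_def, rule LIMSEQ_inverse_real_of_nat)
  show "\<gamma> \<in> weak_topology closure_of Cpl_biM \<mu> \<nu>"
    unfolding in_closure_of topspace_weak_topology
  proof (intro conjI allI impI \<gamma>P)
    fix W assume W: "\<gamma> \<in> W \<and> openin weak_topology W"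
    then have "eventually (\<lambda>n. \<eta> n \<in> W) sequentially"
      unfolding weak_topology_def openin_topology_generated_by_iff
      using weak_topology_eventually[OF _ _ \<eta>P lim] by blast
    then obtain n where "\<eta> n \<in> W" by (auto simp: eventually_sequentially)
    then show "\<exists>y. y \<in> Cpl_biM \<mu> \<nu> \<and> y \<in> W" using \<eta> by blast
  qed
next
  fix p \<epsilon> :: real and dX :: "'a \<Rightarrow> 'a \<Rightarrow> real" and dY :: "'b \<Rightarrow> 'b \<Rightarrow> real" and \<gamma>
  assume p: "1 \<le> p" and dX: "compatible_metric dX" and dY: "compatible_metric dY"
    and \<gamma>: "\<gamma> \<in> Cpl \<mu> \<nu>" and \<epsilon>: "0 < \<epsilon>"
  interpret X: Metric_space UNIV dX using dX by (simp add: compatible_metric_def)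
  interpret Y: Metric_space UNIV dY using dY by (simp add: compatible_metric_def)
  \<comment> \<open>Each coordinate then costs at most
    \<open>\<delta> powr p = \<epsilon> / 4\<close>, which leaves a total of
    \<open>\<epsilon> / 2\<close> and a strict inequality.\<close>
  define \<delta> where "\<delta> = (\<epsilon> / 4) powr (1 / p)"
  have \<delta>: "\<delta> > 0" "\<delta> powr p = \<epsilon> / 4" using \<epsilon> p by (auto simp: \<delta>_def powr_powr)
  obtain \<eta> \<pi> where \<eta>: "\<eta> \<in> Cpl_biM \<mu> \<nu>" and \<pi>: "\<pi> \<in> Cpl \<gamma> \<eta>"
    and close: "AE zw in \<pi>. dX (fst (fst zw)) (fst (snd zw)) < \<delta> \<and> dY (snd (fst zw)) (snd (snd zw)) < \<delta>"
    by (rule Cpl_biM_approx[OF assms(1,3,2,4) dX dY \<gamma> \<delta>(1)])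
  interpret \<pi>: prob_space \<pi> using \<pi> by (simp add: Cpl_def Prob_def)
  \<comment> \<open>The coupling \<open>\<pi>\<close> is one competitor in the infimum, and its cost
    is bounded almost surely.\<close>
  have "Wpp (prod_dist_p dX dY p) \<gamma> \<eta> \<le> (\<integral>\<^sup>+ zw. ennreal (prod_dist_p dX dY p (fst zw) (snd zw)) \<partial>\<pi>)"
    unfolding Wpp_def by (rule INF_lower[OF \<pi>])
  also have "\<dots> \<le> (\<integral>\<^sup>+ zw. ennreal (\<epsilon> / 2) \<partial>\<pi>)"
  proof (rule nn_integral_mono_AE)
    show "AE zw in \<pi>. ennreal (prod_dist_p dX dY p (fst zw) (snd zw)) \<le> ennreal (\<epsilon> / 2)"
      using close
    proof eventually_elim
      case (elim zw)
      then have "dX (fst (fst zw)) (fst (snd zw)) powr p \<le> \<epsilon> / 4" "dY (snd (fst zw)) (snd (snd zw)) powr p \<le> \<epsilon> / 4"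
        unfolding \<delta>(2)[symmetric] using p by (auto intro!: powr_mono2)
      then show ?case by (intro ennreal_leI) (simp add: prod_dist_p_def)
    qed
  qed
  also have "\<dots> = ennreal (\<epsilon> / 2)" by (simp add: \<pi>.emeasure_space_1)
  also have "\<dots> < ennreal \<epsilon>" using \<epsilon> by (simp add: ennreal_less_iff)
  finally show "\<exists>\<eta>\<in>Cpl_biM \<mu> \<nu>. Wpp (prod_dist_p dX dY p) \<gamma> \<eta> < ennreal \<epsilon>" using \<eta> by blast
qed

end
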